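(* Assume that $\lambda>1$, and let $\hat{k}$ be the two-part code MDL estimator $$\hat{k}=\arg\min_k\left[\sum_{i=1}^n\ln\frac{1}{p_k(X_i)}+\lambda\ln\frac{1}{\pi_k}\right].$$ Then for all $\rho\in(0,1/\lambda]$, $$\mathbf{E}_XD_\rho(q\|p_{\hat{k}})\le\mathbf{E}_XD_\rho^{\mathrm{Re}}(q\|p_{\hat{k}})\le\frac{1}{\rho(\lambda-1)}\inf_k\left[D_{\mathrm{KL}}(q\|p_k)+\frac{\lambda}{n}\ln\frac{1}{\pi_k}\right].$$
   Context: $\mathcal{X}$ is a sample space with a measure $\mu$; $q$ is a probability density with respect to $\mu$ (the true density); $X=(X_1,\dots,X_n)$ are $n$ independent samples from $q$; $\mathbf{E}_X$ is expectation over $X$ and $\mathbf{E}_q$ expectation over a single $x\sim q$. The model class is countable: $p_1,p_2,\dots$ are probability densities with respect to $\mu$ ($q$ need not be among them), with prior weights $\pi_j>0$, $\sum_j\pi_j=1$, not depending on $X$. $D_{\mathrm{KL}}(q\|p)=\mathbf{E}_q\ln(q(x)/p(x))$, and for $\rho\in(0,1)$ $$D_\rho(q\|p)=\frac{1}{\rho(1-\rho)}\mathbf{E}_q\Big[1-\Big(\frac{p(x)}{q(x)}\Big)^\rho\Big],\qquad D_\rho^{\mathrm{Re}}(q\|p)=-\frac{1}{\rho(1-\rho)}\ln\mathbf{E}_q\Big(\frac{p(x)}{q(x)}\Big)^\rho .$$ The minimizer $\hat{k}=\hat k(X)$ is assumed to exist, and all quantities are assumed measurable. *)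

theory Defs
  imports "HOL-Probability.Probability"
begin

definition probability_density :: "'a measure \<Rightarrow> ('a \<Rightarrow> real) \<Rightarrow> bool" where
  "probability_density \<mu> f \<longleftrightarrow>
     f \<in> borel_measurable \<mu> \<and> (\<forall>x\<in>space \<mu>. 0 \<le> f x) \<and> (\<integral>\<^sup>+x. ennreal (f x) \<partial>\<mu>) = 1"

text \<open>
  The logarithm with ln 0 = -\<infinity> and ln \<infinity> = \<infinity>. Together with division on
  \<^typ>\<open>ennreal\<close>, where \<open>1 / 0 = \<infinity>\<close>, it gives a density that vanishes at a sample point
  infinite log-loss there.
\<close>

definition ext_ln :: "ennreal \<Rightarrow> ereal" where
  "ext_ln u = (if u = 0 then -\<infinity> else if u = \<infinity> then \<infinity> else ereal (ln (enn2real u)))"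

text \<open>
  Expectation of an extended-real function as the integral of the positive part minus that of the
  negative part (\<^const>\<open>e2ennreal\<close> truncates negative values to 0). The Bochner integral
  and the library's real-valued \<^const>\<open>KL_divergence\<close> are unsuitable here, because they
  return 0 for divergent integrals. In every use below the negative part has a finite integral.
\<close>

definition ext_expectation :: "'a measure \<Rightarrow> ('a \<Rightarrow> ereal) \<Rightarrow> ereal" where
  "ext_expectation M f =
     enn2ereal (\<integral>\<^sup>+x. e2ennreal (f x) \<partial>M) - enn2ereal (\<integral>\<^sup>+x. e2ennreal (- f x) \<partial>M)"

text \<open>
  In the three divergences the integrating measure is the law with density \<open>q\<close>, so the values
  of the integrands where \<open>q x = 0\<close> are irrelevant.
\<close>

definition KL_div :: "'a measure \<Rightarrow> ('a \<Rightarrow> real) \<Rightarrow> ('a \<Rightarrow> real) \<Rightarrow> ereal" where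
  "KL_div \<mu> q p =
     ext_expectation (density \<mu> (\<lambda>x. ennreal (q x))) (\<lambda>x. ext_ln (ennreal (q x) / ennreal (p x)))"

text \<open>For probability densities the integrand below is integrable, as \<open>0 < \<rho> < 1\<close>.\<close>

definition rho_div :: "'a measure \<Rightarrow> real \<Rightarrow> ('a \<Rightarrow> real) \<Rightarrow> ('a \<Rightarrow> real) \<Rightarrow> real" where
  "rho_div \<mu> \<rho> q p =
     1 / (\<rho> * (1 - \<rho>)) * (\<integral>x. 1 - (p x / q x) powr \<rho> \<partial>density \<mu> (\<lambda>x. ennreal (q x)))"

text \<open>Equals \<open>\<infinity>\<close> when \<open>p\<close> and \<open>q\<close> are mutually singular.\<close>

definition Renyi_div :: "'a measure \<Rightarrow> real \<Rightarrow> ('a \<Rightarrow> real) \<Rightarrow> ('a \<Rightarrow> real) \<Rightarrow> ereal" where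
  "Renyi_div \<mu> \<rho> q p =
     - (ereal (1 / (\<rho> * (1 - \<rho>))) *
        ext_ln (\<integral>\<^sup>+x. ennreal ((p x / q x) powr \<rho>) \<partial>density \<mu> (\<lambda>x. ennreal (q x))))"

definition mdl_objective ::
  "('k \<Rightarrow> 'a \<Rightarrow> real) \<Rightarrow> ('k \<Rightarrow> real) \<Rightarrow> real \<Rightarrow> nat \<Rightarrow> (nat \<Rightarrow> 'a) \<Rightarrow> 'k \<Rightarrow> ereal" where
  "mdl_objective p \<pi> l n x k =
     (\<Sum>i<n. ext_ln (1 / ennreal (p k (x i)))) + ereal (l * ln (1 / \<pi> k))"

end

theory Submission
  imports Defs
begin

text \<open>
  Write \<open>a\<^sub>s(k) = \<^bold>E\<^sub>q (p\<^sub>k / q)\<^sup>s\<close> for the affinity of the true density and model \<open>k\<close>; it lies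
  between 0 and 1. Up to the factor \<open>\<rho> (1 - \<rho>)\<close>, the two divergences are \<open>1 - a\<^sub>\<rho>\<close> and
  \<open>- ln a\<^sub>\<rho>\<close>, so the first inequality holds for every model, and hence for the random one.

  For the second inequality, write \<open>\<lambda>\<close> for the parameter \<open>l\<close> and take first \<open>s = 1 / \<lambda>\<close>. By independence,
  \<open>W\<^sub>k = \<Prod>\<^sub>i (p\<^sub>k(X\<^sub>i) / q(X\<^sub>i))\<^sup>s / a\<^sub>s(k)\<^sup>n\<close> has mean at most 1 for each fixed \<open>k\<close>
  (lemma \<open>nn_integral_likelihood_ratio_prod\<close>). Summing against the prior, the random variable
  \<open>V = \<pi>\<^sub>k W\<^sub>k\<close> still has mean at most 1 when \<open>k\<close> is the data-dependent minimizer (lemma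
  \<open>nn_integral_data_dependent_le_1\<close>). Now \<open>ln V \<le> V - 1\<close>, multiplied by \<open>\<lambda>\<close>, says that
  \<open>- \<lambda> n ln a\<^sub>s(k)\<close> is at most \<open>\<lambda> (V - 1)\<close> plus the two-part code length of the minimizer in excess
  of \<open>\<Sum>\<^sub>i ln (1 / q(X\<^sub>i))\<close>. By minimality that excess is at most the excess of any fixed competitor
  (lemma \<open>affinity_code_length_bound\<close>), whose mean is \<open>n\<close> times its Kullback-Leibler divergence plus
  \<open>\<lambda>\<close> times the logarithm of its inverse prior weight. Taking expectations bounds the mean of
  \<open>- \<lambda> ln a\<^sub>s\<close>, which is \<open>\<lambda> - 1\<close> times \<open>s\<close> times the Renyi divergence of order \<open>s\<close>.

  A smaller exponent \<open>\<rho>\<close> costs nothing more, because \<open>\<rho>\<close> times the Renyi divergence of order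
  \<open>\<rho>\<close> is nondecreasing in \<open>\<rho>\<close> (lemma \<open>times_Renyi_div_mono\<close>).

  Two points need care because the densities may vanish. Only competitors of finite divergence
  matter, and these almost surely have a finite code length, hence so does the minimizer. Models
  that are mutually singular with \<open>q\<close> have infinite Renyi divergence, but they are almost surely
  not selected (lemma \<open>AE_selected_affinity_pos\<close>).
\<close>

section \<open>Likelihood ratios under the true density\<close>

lemma prob_space_density_of_probability_density:
  assumes "probability_density \<mu> q"
  shows "prob_space (density \<mu> (\<lambda>x. ennreal (q x)))"
  using assms
  by (intro prob_spaceI) (simp add: probability_density_def emeasure_density cong: nn_integral_cong)

lemma AE_density_pos:
  assumes "q \<in> borel_measurable \<mu>"
  shows "AE x in density \<mu> (\<lambda>x. ennreal (q x)). 0 < q x"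
  using assms by (simp add: AE_density ennreal_less_zero_iff)

text \<open>
  The value is the \<open>p\<close>-mass of the set \<open>q > 0\<close>, which can be strictly less than 1:
  nothing makes \<open>p\<close> absolutely continuous with respect to \<open>q\<close>.
\<close>

lemma nn_integral_likelihood_ratio_le_1:
  assumes q: "probability_density \<mu> q" and p: "probability_density \<mu> p"
  shows "(\<integral>\<^sup>+x. ennreal (p x / q x) \<partial>density \<mu> (\<lambda>x. ennreal (q x))) \<le> 1"
proof -
  have [measurable]: "q \<in> borel_measurable \<mu>" "p \<in> borel_measurable \<mu>"
    using q p by (auto simp: probability_density_def)
  have "(\<integral>\<^sup>+x. ennreal (p x / q x) \<partial>density \<mu> (\<lambda>x. ennreal (q x)))
      = (\<integral>\<^sup>+x. ennreal (q x) * ennreal (p x / q x) \<partial>\<mu>)"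
    by (subst nn_integral_density) auto
  also have "\<dots> \<le> (\<integral>\<^sup>+x. ennreal (p x) \<partial>\<mu>)"
    using q p
    by (intro nn_integral_mono)
       (auto simp: probability_density_def ennreal_mult'[symmetric] intro!: ennreal_leI)
  finally show ?thesis
    using p by (simp add: probability_density_def)
qed

lemma integral_likelihood_ratio_le_1:
  assumes q: "probability_density \<mu> q" and p: "probability_density \<mu> p"
  shows "integrable (density \<mu> (\<lambda>x. ennreal (q x))) (\<lambda>x. p x / q x)"
    and "(\<integral>x. p x / q x \<partial>density \<mu> (\<lambda>x. ennreal (q x))) \<le> 1"
proof -
  let ?D = "density \<mu> (\<lambda>x. ennreal (q x))"
  have [measurable]: "q \<in> borel_measurable \<mu>" "p \<in> borel_measurable \<mu>"
    using q p by (auto simp: probability_density_def)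
  have nonneg: "AE x in ?D. 0 \<le> p x / q x"
    using q p by (intro AE_I2) (auto simp: probability_density_def)
  show *: "integrable ?D (\<lambda>x. p x / q x)"
    using nn_integral_likelihood_ratio_le_1[OF q p]
    by (intro integrableI_nonneg nonneg) (auto simp: le_less_trans)
  show "(\<integral>x. p x / q x \<partial>?D) \<le> 1"
    using nn_integral_eq_integral[OF * nonneg] nn_integral_likelihood_ratio_le_1[OF q p]
    by simp
qed

section \<open>The affinity of two densities\<close>

text \<open>
  This is the Hellinger integral \<open>\<integral> p\<^sup>\<rho> q\<^sup>1\<^sup>-\<^sup>\<rho> d\<mu>\<close> (Chernoff's coefficient), written as a
  moment of the likelihood ratio. Both \<open>D\<^sub>\<rho>\<close> and the Renyi divergence are functions of
  this one number.
\<close>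

definition affinity :: "'a measure \<Rightarrow> real \<Rightarrow> ('a \<Rightarrow> real) \<Rightarrow> ('a \<Rightarrow> real) \<Rightarrow> real" where
  "affinity \<mu> \<rho> q p = (\<integral>x. (p x / q x) powr \<rho> \<partial>density \<mu> (\<lambda>x. ennreal (q x)))"

text \<open>
  Young's inequality extended to vanishing arguments, since a density may vanish. It serves twice:
  with \<open>b = 1\<close> it bounds powers of the likelihood ratio by an integrable affine function, and
  in the interpolation below it takes the place of Hoelder's inequality.
\<close>

lemma weighted_am_gm:
  fixes a b t :: real
  assumes "0 \<le> a" "0 \<le> b" "0 \<le> t" "t \<le> 1"
  shows "a powr t * b powr (1 - t) \<le> t * a + (1 - t) * b"
proof (cases "a = 0 \<or> b = 0")
  case True
  then show ?thesis using assms by auto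
next
  case False
  then show ?thesis using assms Youngs_inequality_0[of t "1 - t" a b] by simp
qed

lemma integrable_likelihood_ratio_powr:
  assumes q: "probability_density \<mu> q" and p: "probability_density \<mu> p"
    and \<rho>: "0 < \<rho>" "\<rho> < 1"
  shows "integrable (density \<mu> (\<lambda>x. ennreal (q x))) (\<lambda>x. (p x / q x) powr \<rho>)"
proof -
  interpret D: prob_space "density \<mu> (\<lambda>x. ennreal (q x))"
    by (rule prob_space_density_of_probability_density[OF q])
  have [measurable]: "q \<in> borel_measurable \<mu>" "p \<in> borel_measurable \<mu>"
    using q p by (auto simp: probability_density_def)
  have le: "(p x / q x) powr \<rho> \<le> \<rho> * (p x / q x) + (1 - \<rho>)" if "x \<in> space \<mu>" for x
    using weighted_am_gm[of "p x / q x" 1 \<rho>] q p \<rho> that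
    by (auto simp: probability_density_def)
  show ?thesis
    by (rule Bochner_Integration.integrable_bound[where f = "\<lambda>x. \<rho> * (p x / q x) + (1 - \<rho>)"])
       (use integral_likelihood_ratio_le_1(1)[OF q p] in
         \<open>auto simp del: times_divide_eq_right intro!: AE_I2 order_trans[OF le abs_ge_self]\<close>)
qed

lemma affinity_nonneg: "0 \<le> affinity \<mu> \<rho> q p"
  by (simp add: affinity_def)

lemma affinity_le_1:
  assumes q: "probability_density \<mu> q" and p: "probability_density \<mu> p"
    and \<rho>: "0 < \<rho>" "\<rho> < 1"
  shows "affinity \<mu> \<rho> q p \<le> 1"
proof -
  let ?D = "density \<mu> (\<lambda>x. ennreal (q x))"
  interpret D: prob_space ?D
    by (rule prob_space_density_of_probability_density[OF q])
  have "affinity \<mu> \<rho> q p \<le> (\<integral>x. \<rho> * (p x / q x) + (1 - \<rho>) \<partial>?D)"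
    unfolding affinity_def
    using weighted_am_gm[of "p _ / q _" 1 \<rho>] q p \<rho>
    by (intro integral_mono integrable_likelihood_ratio_powr[OF q p \<rho>]
          Bochner_Integration.integrable_add integrable_mult_right
          integral_likelihood_ratio_le_1(1)[OF q p])
       (auto simp: probability_density_def)
  also have "\<dots> = \<rho> * (\<integral>x. p x / q x \<partial>?D) + (1 - \<rho>)"
    using integral_likelihood_ratio_le_1(1)[OF q p]
    by (subst Bochner_Integration.integral_add) (auto simp: D.prob_space[simplified] simp del: times_divide_eq_right)
  also have "\<dots> \<le> \<rho> * 1 + (1 - \<rho>)"
    using integral_likelihood_ratio_le_1(2)[OF q p] \<rho> by (intro add_right_mono mult_left_mono) auto
  finally show ?thesis by simp
qed

lemma nn_integral_likelihood_ratio_powr: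
  assumes q: "probability_density \<mu> q" and p: "probability_density \<mu> p"
    and \<rho>: "0 < \<rho>" "\<rho> < 1"
  shows "(\<integral>\<^sup>+x. ennreal ((p x / q x) powr \<rho>) \<partial>density \<mu> (\<lambda>x. ennreal (q x)))
    = ennreal (affinity \<mu> \<rho> q p)"
  unfolding affinity_def
  by (rule nn_integral_eq_integral[OF integrable_likelihood_ratio_powr[OF q p \<rho>]]) auto

lemma rho_div_eq_affinity:
  assumes q: "probability_density \<mu> q" and p: "probability_density \<mu> p"
    and \<rho>: "0 < \<rho>" "\<rho> < 1"
  shows "rho_div \<mu> \<rho> q p = (1 - affinity \<mu> \<rho> q p) / (\<rho> * (1 - \<rho>))"
proof -
  interpret D: prob_space "density \<mu> (\<lambda>x. ennreal (q x))"
    by (rule prob_space_density_of_probability_density[OF q])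
  show ?thesis
    unfolding rho_div_def affinity_def
    using integrable_likelihood_ratio_powr[OF q p \<rho>]
    by (subst Bochner_Integration.integral_diff) (auto simp: D.prob_space[simplified])
qed

lemma Renyi_div_eq_affinity:
  assumes q: "probability_density \<mu> q" and p: "probability_density \<mu> p"
    and \<rho>: "0 < \<rho>" "\<rho> < 1"
  shows "Renyi_div \<mu> \<rho> q p =
    (if affinity \<mu> \<rho> q p = 0 then \<infinity> else ereal (- ln (affinity \<mu> \<rho> q p) / (\<rho> * (1 - \<rho>))))"
  using affinity_nonneg[of \<mu> \<rho> q p] \<rho>
  by (auto simp: Renyi_div_def nn_integral_likelihood_ratio_powr[OF q p \<rho>] ext_ln_def)

lemma Renyi_div_nonneg:
  assumes q: "probability_density \<mu> q" and p: "probability_density \<mu> p"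
    and \<rho>: "0 < \<rho>" "\<rho> < 1"
  shows "0 \<le> Renyi_div \<mu> \<rho> q p"
  using affinity_nonneg[of \<mu> \<rho> q p] affinity_le_1[OF q p \<rho>] \<rho>
  by (auto simp: Renyi_div_eq_affinity[OF q p \<rho>] divide_nonpos_pos)

text \<open>
  In terms of the affinity \<open>a\<close>, this is \<open>1 - a \<le> - ln a\<close>.
\<close>

lemma rho_div_le_Renyi_div:
  assumes q: "probability_density \<mu> q" and p: "probability_density \<mu> p"
    and \<rho>: "0 < \<rho>" "\<rho> < 1"
  shows "ereal (rho_div \<mu> \<rho> q p) \<le> Renyi_div \<mu> \<rho> q p"
proof (cases "affinity \<mu> \<rho> q p = 0")
  case False
  then have "ln (affinity \<mu> \<rho> q p) \<le> affinity \<mu> \<rho> q p - 1"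
    using affinity_nonneg[of \<mu> \<rho> q p] by (intro ln_le_minus_one) auto
  then have "(1 - affinity \<mu> \<rho> q p) / (\<rho> * (1 - \<rho>)) \<le> - ln (affinity \<mu> \<rho> q p) / (\<rho> * (1 - \<rho>))"
    using \<rho> by (intro divide_right_mono) auto
  then show ?thesis
    using False
    by (simp add: Renyi_div_eq_affinity[OF q p \<rho>] rho_div_eq_affinity[OF q p \<rho>])
qed (simp add: Renyi_div_eq_affinity[OF q p \<rho>])

text \<open>
  The logarithm of the affinity is convex in the exponent, and at exponent 1 it is at most 0. With
  \<open>t = (1 - \<sigma>) / (1 - \<rho>)\<close> one has \<open>\<sigma> = t \<rho> + (1 - t)\<close>, so the bound is the chord between the
  exponents \<open>\<rho>\<close> and 1. Instead of citing Hoelder's inequality, the integrand is divided by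
  \<open>a\<^sub>\<rho>\<^sup>t\<close>, where \<open>a\<^sub>\<rho>\<close> is the affinity at \<open>\<rho>\<close>, and bounded pointwise by the weighted
  inequality of the means.
\<close>

lemma affinity_interpolation:
  assumes q: "probability_density \<mu> q" and p: "probability_density \<mu> p"
    and \<rho>: "0 < \<rho>" "\<rho> \<le> \<sigma>" "\<sigma> < 1"
  shows "affinity \<mu> \<sigma> q p \<le> affinity \<mu> \<rho> q p powr ((1 - \<sigma>) / (1 - \<rho>))"
proof -
  let ?D = "density \<mu> (\<lambda>x. ennreal (q x))"
  let ?A = "affinity \<mu> \<rho> q p" and ?r = "\<lambda>x. p x / q x"
  define t where "t = (1 - \<sigma>) / (1 - \<rho>)"
  have t: "0 < t" "t \<le> 1"
    using \<rho> by (auto simp: t_def)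
  have \<sigma>_eq: "\<rho> * t + (1 - t) = \<sigma>"
  proof -
    have "t * (1 - \<rho>) = 1 - \<sigma>"
      using \<rho> by (simp add: t_def)
    then show ?thesis by (simp add: algebra_simps)
  qed
  have int: "integrable ?D (\<lambda>x. ?r x powr \<rho>)" "integrable ?D (\<lambda>x. ?r x powr \<sigma>)"
    using integrable_likelihood_ratio_powr[OF q p] \<rho> by auto
  have r_nonneg: "0 \<le> ?r x" if "x \<in> space \<mu>" for x
    using q p that by (auto simp: probability_density_def)
  have split: "?r x powr \<sigma> = (?r x powr \<rho>) powr t * ?r x powr (1 - t)" if "x \<in> space \<mu>" for x
    by (simp add: powr_powr powr_add[symmetric] \<sigma>_eq)
  show ?thesis
  proof (cases "?A = 0")
    case True
    then have "AE x in ?D. ?r x powr \<rho> = 0"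
      using integral_nonneg_eq_0_iff_AE[OF int(1)] by (simp add: affinity_def)
    then have "AE x in ?D. ?r x powr \<sigma> = 0"
      by eventually_elim auto
    then have "affinity \<mu> \<sigma> q p = 0"
      unfolding affinity_def using integral_nonneg_eq_0_iff_AE[OF int(2)] by simp
    then show ?thesis by simp
  next
    case False
    then have A: "0 < ?A"
      using affinity_nonneg[of \<mu> \<rho> q p] by simp
    have "?r x powr \<sigma> / ?A powr t \<le> t * (?r x powr \<rho> / ?A) + (1 - t) * ?r x"
      if "x \<in> space \<mu>" for x
      using weighted_am_gm[of "?r x powr \<rho> / ?A" "?r x" t] r_nonneg[OF that] t A
      unfolding split[OF that] by (subst (asm) powr_divide) (auto simp del: times_divide_eq_right)
    then have "(\<integral>x. ?r x powr \<sigma> / ?A powr t \<partial>?D)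
        \<le> (\<integral>x. t * (?r x powr \<rho> / ?A) + (1 - t) * ?r x \<partial>?D)"
      by (intro integral_mono Bochner_Integration.integrable_add integrable_mult_right
            integrable_divide int integral_likelihood_ratio_le_1(1)[OF q p]) auto
    also have "\<dots> = t * (?A / ?A) + (1 - t) * (\<integral>x. ?r x \<partial>?D)"
      using int(1) integral_likelihood_ratio_le_1(1)[OF q p]
      by (subst Bochner_Integration.integral_add) (auto simp: affinity_def simp del: times_divide_eq_right)
    also have "\<dots> \<le> t * 1 + (1 - t) * 1"
      using t A integral_likelihood_ratio_le_1(2)[OF q p]
      by (intro add_mono mult_left_mono) auto
    finally have "affinity \<mu> \<sigma> q p / ?A powr t \<le> 1"
      by (simp add: affinity_def)
    then show ?thesis
      using A by (simp add: t_def field_simps)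
  qed
qed

text \<open>
  The divergence of order \<open>\<rho>\<close> times \<open>\<rho>\<close> is \<open>- ln a\<^sub>\<rho> / (1 - \<rho>)\<close>, where \<open>a\<^sub>\<rho>\<close> is the affinity, so this is
  the interpolation inequality after taking logarithms. It reduces the risk bound to the single
  exponent \<open>1 / \<lambda>\<close>, with exactly the constant that the general exponent needs.
\<close>

lemma times_Renyi_div_mono:
  assumes q: "probability_density \<mu> q" and p: "probability_density \<mu> p"
    and \<rho>: "0 < \<rho>" "\<rho> \<le> \<sigma>" "\<sigma> < 1"
  shows "ereal \<rho> * Renyi_div \<mu> \<rho> q p \<le> ereal \<sigma> * Renyi_div \<mu> \<sigma> q p"
proof -
  let ?A = "\<lambda>s. affinity \<mu> s q p"
  have \<rho>': "0 < \<rho>" "\<rho> < 1" and \<sigma>': "0 < \<sigma>" "\<sigma> < 1"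
    using \<rho> by auto
  show ?thesis
  proof (cases "?A \<sigma> = 0")
    case True
    then show ?thesis
      using \<sigma>' by (simp add: Renyi_div_eq_affinity[OF q p \<sigma>'])
  next
    case False
    then have \<sigma>_pos: "0 < ?A \<sigma>"
      using affinity_nonneg[of \<mu> \<sigma> q p] by simp
    have le: "?A \<sigma> \<le> ?A \<rho> powr ((1 - \<sigma>) / (1 - \<rho>))"
      by (rule affinity_interpolation[OF q p \<rho>])
    then have \<rho>_pos: "0 < ?A \<rho>"
      using \<sigma>_pos affinity_nonneg[of \<mu> \<rho> q p] by (cases "?A \<rho> = 0") auto
    have "ln (?A \<sigma>) \<le> ln (?A \<rho> powr ((1 - \<sigma>) / (1 - \<rho>)))"
      using le \<sigma>_pos \<rho>_pos by (subst ln_le_cancel_iff) auto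
    also have "\<dots> = (1 - \<sigma>) / (1 - \<rho>) * ln (?A \<rho>)"
      using \<rho>_pos by (simp add: ln_powr)
    finally have "- ln (?A \<rho>) / (1 - \<rho>) \<le> - ln (?A \<sigma>) / (1 - \<sigma>)"
      using \<rho>' \<sigma>' by (simp add: field_simps)
    then show ?thesis
      using \<rho>' \<sigma>' \<rho>_pos \<sigma>_pos
      by (simp add: Renyi_div_eq_affinity[OF q p \<rho>'] Renyi_div_eq_affinity[OF q p \<sigma>'])
  qed
qed

section \<open>Extended-real expectations\<close>

lemma ext_expectation_mono:
  assumes "\<And>x. x \<in> space M \<Longrightarrow> f x \<le> g x"
  shows "ext_expectation M f \<le> ext_expectation M g"
  unfolding ext_expectation_def
  using assms
  by (intro ereal_minus_mono) (auto simp flip: less_eq_ennreal.rep_eq intro!: nn_integral_mono e2ennreal_mono)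

text \<open>
  A random divergence may be infinite on a null set, and its bound by a real random variable holds
  only almost surely; since it is nonnegative, the bound still passes to the expectation.
\<close>

lemma ext_expectation_le_integral:
  assumes G: "integrable M G"
    and f: "\<And>x. x \<in> space M \<Longrightarrow> 0 \<le> f x" "AE x in M. f x \<le> ereal (G x)"
  shows "ext_expectation M f \<le> ereal (\<integral>x. G x \<partial>M)"
proof -
  have G_nonneg: "AE x in M. 0 \<le> G x"
    using f(2) AE_space
  proof eventually_elim
    case (elim x)
    then have "0 \<le> ereal (G x)" using f(1) order_trans by blast
    then show ?case by simp
  qed
  have "(\<integral>\<^sup>+x. e2ennreal (f x) \<partial>M) \<le> (\<integral>\<^sup>+x. ennreal (G x) \<partial>M)"
    using f(2) by (intro nn_integral_mono_AE) (auto simp flip: e2ennreal_ereal intro: e2ennreal_mono)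
  also have "\<dots> = ennreal (\<integral>x. G x \<partial>M)"
    by (rule nn_integral_eq_integral[OF G G_nonneg])
  finally have "enn2ereal (\<integral>\<^sup>+x. e2ennreal (f x) \<partial>M) \<le> enn2ereal (ennreal (\<integral>x. G x \<partial>M))"
    by (simp add: less_eq_ennreal.rep_eq)
  moreover have "(\<integral>\<^sup>+x. e2ennreal (- f x) \<partial>M) = 0"
    using f(1) by (subst nn_integral_cong[where v = "\<lambda>_. 0"]) (auto simp: e2ennreal_neg)
  ultimately show ?thesis
    using integral_nonneg_AE[OF G_nonneg] by (simp add: ext_expectation_def zero_ennreal.rep_eq)
qed

lemma ext_expectation_finite:
  assumes g: "g \<in> borel_measurable M"
    and fg: "AE x in M. f x = ereal (g x)"
    and neg: "(\<integral>\<^sup>+x. ennreal (- g x) \<partial>M) < \<infinity>"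
    and fin: "ext_expectation M f < \<infinity>"
  shows "integrable M g" and "ext_expectation M f = ereal (\<integral>x. g x \<partial>M)"
proof -
  have eq: "(\<integral>\<^sup>+x. e2ennreal (f x) \<partial>M) = (\<integral>\<^sup>+x. ennreal (g x) \<partial>M)"
      "(\<integral>\<^sup>+x. e2ennreal (- f x) \<partial>M) = (\<integral>\<^sup>+x. ennreal (- g x) \<partial>M)"
    using fg by (auto intro!: nn_integral_cong_AE simp flip: e2ennreal_ereal elim!: eventually_mono)
  let ?P = "\<integral>\<^sup>+x. ennreal (g x) \<partial>M" and ?N = "\<integral>\<^sup>+x. ennreal (- g x) \<partial>M"
  obtain b where b: "?N = ennreal b" "0 \<le> b"
    using neg by (cases ?N) auto
  have "?P \<noteq> \<infinity>"
    using fin b by (auto simp: ext_expectation_def eq)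
  then obtain a where a: "?P = ennreal a" "0 \<le> a"
    by (cases ?P) auto
  show int: "integrable M g"
    using g a b by (simp add: real_integrable_def)
  show "ext_expectation M f = ereal (\<integral>x. g x \<partial>M)"
    using a b by (simp add: ext_expectation_def eq real_lebesgue_integral_def[OF int])
qed

section \<open>Finite Kullback-Leibler divergence\<close>

lemma borel_measurable_ext_ln [measurable]: "ext_ln \<in> borel_measurable borel"
  unfolding ext_ln_def[abs_def] by measurable

lemma ext_ln_divide:
  assumes "0 < a" "0 \<le> b"
  shows "ext_ln (ennreal a / ennreal b) = (if b = 0 then \<infinity> else ereal (ln (a / b)))"
  using assms by (auto simp: ext_ln_def divide_ennreal ennreal_divide_eq_top_iff)

text \<open>
  The negative part of the log-likelihood ratio is always integrable, because
  \<open>ln (p / q) \<le> p / q\<close>. A finite divergence therefore forces the positive part to be integrable,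
  and in particular to be finite almost surely: \<open>p\<close> cannot vanish on a set of positive
  \<open>q\<close>-measure.
\<close>

lemma KL_div_finite:
  assumes q: "probability_density \<mu> q" and p: "probability_density \<mu> p"
    and fin: "KL_div \<mu> q p < \<infinity>"
  shows "AE x in density \<mu> (\<lambda>x. ennreal (q x)). 0 < p x"
    and "integrable (density \<mu> (\<lambda>x. ennreal (q x))) (\<lambda>x. ln (q x / p x))"
    and "KL_div \<mu> q p = ereal (\<integral>x. ln (q x / p x) \<partial>density \<mu> (\<lambda>x. ennreal (q x)))"
proof -
  let ?D = "density \<mu> (\<lambda>x. ennreal (q x))"
  let ?f = "\<lambda>x. ext_ln (ennreal (q x) / ennreal (p x))"
  have [measurable]: "q \<in> borel_measurable \<mu>" "p \<in> borel_measurable \<mu>"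
    using q p by (auto simp: probability_density_def)
  have q_pos: "AE x in ?D. 0 < q x"
    by (rule AE_density_pos) measurable
  have p_nonneg: "AE x in ?D. 0 \<le> p x"
    using p by (intro AE_I2) (auto simp: probability_density_def)
  have neg: "ennreal (- ln (q x / p x)) \<le> ennreal (p x / q x)" if "0 < q x" "0 \<le> p x" for x
  proof (cases "p x = 0")
    case False
    then have "ln (p x / q x) \<le> p x / q x"
      using that by (intro ln_bound) auto
    then show ?thesis
      using that False by (auto simp: ln_div intro!: ennreal_leI)
  qed simp
  have bounded: "(\<integral>\<^sup>+x. h x \<partial>?D) < \<infinity>" if "AE x in ?D. h x \<le> ennreal (p x / q x)" for h
    using order_trans[OF nn_integral_mono_AE[OF that] nn_integral_likelihood_ratio_le_1[OF q p]]
    by (auto simp: le_less_trans)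
  have "AE x in ?D. e2ennreal (- ?f x) \<le> ennreal (p x / q x)"
    using q_pos p_nonneg
    by eventually_elim (use neg in \<open>auto simp: ext_ln_divide e2ennreal_neg\<close>)
  then have f_neg: "(\<integral>\<^sup>+x. e2ennreal (- ?f x) \<partial>?D) < \<infinity>"
    by (rule bounded)
  have "(\<integral>\<^sup>+x. e2ennreal (?f x) \<partial>?D) \<noteq> \<infinity>"
  proof
    assume *: "(\<integral>\<^sup>+x. e2ennreal (?f x) \<partial>?D) = \<infinity>"
    show False
      using fin f_neg unfolding KL_div_def ext_expectation_def *
      by (cases "\<integral>\<^sup>+x. e2ennreal (- ?f x) \<partial>?D") auto
  qed
  then have "AE x in ?D. e2ennreal (?f x) \<noteq> \<infinity>"
    by (intro nn_integral_PInf_AE) auto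
  then show p_pos: "AE x in ?D. 0 < p x"
    using q_pos p_nonneg
  proof eventually_elim
    case (elim x)
    then show ?case by (cases "p x = 0") (auto simp: ext_ln_divide ext_ln_def)
  qed
  have f_eq: "AE x in ?D. ?f x = ereal (ln (q x / p x))"
    using p_pos q_pos by eventually_elim (auto simp: ext_ln_divide)
  have "AE x in ?D. ennreal (- ln (q x / p x)) \<le> ennreal (p x / q x)"
    using q_pos p_nonneg by eventually_elim (rule neg)
  then have neg_fin: "(\<integral>\<^sup>+x. ennreal (- ln (q x / p x)) \<partial>?D) < \<infinity>"
    by (rule bounded)
  show "integrable ?D (\<lambda>x. ln (q x / p x))"
    by (rule ext_expectation_finite[OF _ f_eq neg_fin fin[unfolded KL_div_def]]) measurable
  show "KL_div \<mu> q p = ereal (\<integral>x. ln (q x / p x) \<partial>?D)"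
    unfolding KL_div_def
    by (rule ext_expectation_finite[OF _ f_eq neg_fin fin[unfolded KL_div_def]]) measurable
qed

section \<open>Union bound over the prior\<close>

lemma nn_integral_prior:
  fixes \<pi> :: "'k \<Rightarrow> real"
  assumes "\<And>k. 0 \<le> \<pi> k" and sum: "(\<pi> has_sum s) UNIV"
  shows "(\<integral>\<^sup>+k. ennreal (\<pi> k) \<partial>count_space UNIV) = ennreal s"
proof -
  have "\<pi> summable_on UNIV"
    using sum by (auto simp: summable_on_def)
  then have "(\<lambda>k. norm (\<pi> k)) summable_on UNIV"
    using assms by simp
  then have abs: "Infinite_Set_Sum.abs_summable_on \<pi> UNIV"
    by (simp only: abs_summable_equivalent)
  have "(\<integral>\<^sup>+k. ennreal (\<pi> k) \<partial>count_space UNIV) = ennreal (infsetsum \<pi> UNIV)"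
    by (rule nn_integral_conv_infsetsum) (use abs assms in auto)
  also have "infsetsum \<pi> UNIV = s"
    using infsetsum_infsum[OF abs] infsumI[OF sum] by simp
  finally show ?thesis .
qed

text \<open>
  The selection \<open>K\<close> may depend on the data in any way: the selected term is at most the sum of
  all terms, and the sum has expectation at most the total prior mass. This is where the prior pays
  for the choice of a model after seeing the sample.
\<close>

lemma nn_integral_data_dependent_le_1:
  fixes \<pi> :: "'k::countable \<Rightarrow> real" and W :: "'k \<Rightarrow> 'w \<Rightarrow> real"
  assumes \<pi>: "\<And>k. 0 \<le> \<pi> k" "(\<pi> has_sum 1) UNIV"
    and W [measurable]: "\<And>k. W k \<in> borel_measurable M"
    and W_le: "\<And>k. (\<integral>\<^sup>+\<omega>. ennreal (W k \<omega>) \<partial>M) \<le> 1"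
  shows "(\<integral>\<^sup>+\<omega>. ennreal (\<pi> (K \<omega>) * W (K \<omega>) \<omega>) \<partial>M) \<le> 1"
proof -
  have "(\<integral>\<^sup>+\<omega>. ennreal (\<pi> (K \<omega>) * W (K \<omega>) \<omega>) \<partial>M)
      \<le> (\<integral>\<^sup>+\<omega>. \<integral>\<^sup>+k. ennreal (\<pi> k) * ennreal (W k \<omega>) \<partial>count_space UNIV \<partial>M)"
  proof (rule nn_integral_mono)
    fix \<omega>
    show "ennreal (\<pi> (K \<omega>) * W (K \<omega>) \<omega>)
        \<le> (\<integral>\<^sup>+k. ennreal (\<pi> k) * ennreal (W k \<omega>) \<partial>count_space UNIV)"
      using nn_integral_ge_point[of "K \<omega>" UNIV "\<lambda>k. ennreal (\<pi> k) * ennreal (W k \<omega>)"]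
      by (simp add: ennreal_mult' \<pi>)
  qed
  also have "\<dots> = (\<integral>\<^sup>+k. \<integral>\<^sup>+\<omega>. ennreal (\<pi> k) * ennreal (W k \<omega>) \<partial>M \<partial>count_space UNIV)"
    by (intro nn_integral_count_space_nn_integral) auto
  also have "\<dots> = (\<integral>\<^sup>+k. ennreal (\<pi> k) * (\<integral>\<^sup>+\<omega>. ennreal (W k \<omega>) \<partial>M) \<partial>count_space UNIV)"
    by (intro nn_integral_cong nn_integral_cmult) auto
  also have "\<dots> \<le> (\<integral>\<^sup>+k. ennreal (\<pi> k) * 1 \<partial>count_space UNIV)"
    by (intro nn_integral_mono mult_left_mono W_le) auto
  also have "\<dots> = 1"
    using nn_integral_prior[OF \<pi>] by simp
  finally show ?thesis .
qed

section \<open>The two-part code\<close>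

lemma ext_ln_code_length:
  assumes "0 \<le> a"
  shows "ext_ln (1 / ennreal a) = (if a = 0 then \<infinity> else ereal (- ln a))"
  using ext_ln_divide[of 1 a] assms by (simp add: ln_div)

lemma mdl_objective_eq:
  assumes "\<And>i. i < n \<Longrightarrow> 0 \<le> p k (x i)"
  shows "mdl_objective p \<pi> l n x k =
    (if \<exists>i<n. p k (x i) = 0 then \<infinity>
     else ereal ((\<Sum>i<n. - ln (p k (x i))) + l * ln (1 / \<pi> k)))"
proof (cases "\<exists>i<n. p k (x i) = 0")
  case True
  then obtain j where "j < n" "p k (x j) = 0" by auto
  then have "(\<Sum>i<n. ext_ln (1 / ennreal (p k (x i)))) = \<infinity>"
    by (subst sum_Pinfty) (auto simp: ext_ln_def intro!: bexI[of _ j])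
  with True show ?thesis
    by (simp add: mdl_objective_def)
next
  case False
  have "(\<Sum>i<n. ext_ln (1 / ennreal (p k (x i)))) = (\<Sum>i<n. ereal (- ln (p k (x i))))"
    using assms False by (intro sum.cong) (auto simp: ext_ln_code_length)
  then show ?thesis
    using False by (simp add: mdl_objective_def)
qed

text \<open>
  The minimizer inherits a finite code length from any competitor that has one, so it gives positive
  likelihood to every sample point, and the comparison of objectives is one of real numbers.
\<close>

lemma mdl_minimizer_code_length:
  assumes nonneg: "\<And>k i. i < n \<Longrightarrow> 0 \<le> p k (x i)"
    and min: "is_arg_min (mdl_objective p \<pi> l n x) (\<lambda>_. True) k"
    and pos: "\<And>i. i < n \<Longrightarrow> 0 < p k0 (x i)"
  shows "\<And>i. i < n \<Longrightarrow> 0 < p k (x i)"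
    and "(\<Sum>i<n. - ln (p k (x i))) + l * ln (1 / \<pi> k)
      \<le> (\<Sum>i<n. - ln (p k0 (x i))) + l * ln (1 / \<pi> k0)"
proof -
  have le: "mdl_objective p \<pi> l n x k \<le> mdl_objective p \<pi> l n x k0"
    using min by (auto simp: is_arg_min_def not_less)
  have k0: "\<not> (\<exists>i<n. p k0 (x i) = 0)"
    using pos by force
  have k: "\<not> (\<exists>i<n. p k (x i) = 0)"
  proof
    assume "\<exists>i<n. p k (x i) = 0"
    with le k0 show False
      by (simp add: mdl_objective_eq[of n p, OF nonneg])
  qed
  show "0 < p k (x i)" if "i < n" for i
    using k nonneg[OF that, of k] that by force
  show "(\<Sum>i<n. - ln (p k (x i))) + l * ln (1 / \<pi> k)
      \<le> (\<Sum>i<n. - ln (p k0 (x i))) + l * ln (1 / \<pi> k0)"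
    using le k k0 by (simp add: mdl_objective_eq[of n p, OF nonneg])
qed

text \<open>
  The heart of the argument, for one fixed sample. The inequality \<open>ln V \<le> V - 1\<close> replaces Jensen's
  inequality for the logarithm, and \<open>ln V\<close> expands into \<open>- n ln A\<close> minus \<open>1 / \<lambda>\<close> times the excess
  code length of the selected model over \<open>q\<close>. The exponent \<open>1 / \<lambda>\<close> is chosen so that the data
  term and the prior term occur in the same proportion as in the objective; hence minimality of the
  code length applies and the competitor \<open>k0\<close> takes the place of the selected model.
\<close>

lemma affinity_code_length_bound:
  fixes p :: "'k \<Rightarrow> 'a \<Rightarrow> real" and q :: "'a \<Rightarrow> real" and \<pi> :: "'k \<Rightarrow> real"
    and n :: nat and l A :: real
  defines "V \<equiv> \<lambda>k x. \<pi> k * ((\<Prod>i<n. (p k (x i) / q (x i)) powr (1 / l)) / A ^ n)"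
  assumes nonneg: "\<And>k i. i < n \<Longrightarrow> 0 \<le> p k (x i)"
    and q_pos: "\<And>i. i < n \<Longrightarrow> 0 < q (x i)"
    and pos: "\<And>i. i < n \<Longrightarrow> 0 < p k0 (x i)"
    and \<pi>: "\<And>k. 0 < \<pi> k" and l: "0 < l" and A: "0 < A"
    and min: "is_arg_min (mdl_objective p \<pi> l n x) (\<lambda>_. True) k"
  shows "l * real n * (- ln A)
    \<le> l * (V k x - 1) + (\<Sum>i<n. ln (q (x i) / p k0 (x i))) + l * ln (1 / \<pi> k0)"
proof -
  have p_pos: "0 < p k (x i)" if "i < n" for i
    by (rule mdl_minimizer_code_length(1)[of n p x \<pi> l k k0]) (use nonneg min pos that in auto)
  have code: "(\<Sum>i<n. - ln (p k (x i))) + l * ln (1 / \<pi> k)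
      \<le> (\<Sum>i<n. - ln (p k0 (x i))) + l * ln (1 / \<pi> k0)"
    by (rule mdl_minimizer_code_length(2)[of n p x \<pi> l k k0]) (use nonneg min pos in auto)
  have factor_pos: "0 < (p k (x i) / q (x i)) powr (1 / l)" if "i < n" for i
    using p_pos[OF that] q_pos[OF that] by simp
  have prod_pos: "0 < (\<Prod>i<n. (p k (x i) / q (x i)) powr (1 / l))"
    by (rule prod_pos) (use factor_pos in auto)
  have V_pos: "0 < V k x"
    using prod_pos \<pi>[of k] A by (simp add: V_def)
  have "ln (\<Prod>i<n. (p k (x i) / q (x i)) powr (1 / l))
      = (\<Sum>i<n. ln ((p k (x i) / q (x i)) powr (1 / l)))"
    by (rule ln_prod) (use factor_pos in auto)
  also have "\<dots> = (\<Sum>i<n. (ln (p k (x i)) - ln (q (x i))) / l)"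
    using p_pos q_pos by (intro sum.cong) (auto simp: ln_powr ln_div less_imp_neq[symmetric])
  also have "\<dots> = (\<Sum>i<n. ln (p k (x i)) - ln (q (x i))) / l"
    by (simp add: sum_divide_distrib)
  finally have ln_prod: "ln (\<Prod>i<n. (p k (x i) / q (x i)) powr (1 / l))
      = (\<Sum>i<n. ln (p k (x i)) - ln (q (x i))) / l" .
  have "ln (V k x) = ln (\<pi> k) + ((\<Sum>i<n. ln (p k (x i)) - ln (q (x i))) / l - n * ln A)"
  proof -
    let ?P = "\<Prod>i<n. (p k (x i) / q (x i)) powr (1 / l)"
    have "ln (V k x) = ln (\<pi> k) + ln (?P / A ^ n)"
      unfolding V_def using prod_pos \<pi>[of k] A by (intro ln_mult_pos divide_pos_pos) auto
    also have "ln (?P / A ^ n) = ln ?P - ln (A ^ n)"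
      using prod_pos A by (intro ln_divide_pos) auto
    finally show ?thesis
      using A by (simp only: ln_prod ln_realpow)
  qed
  moreover have "ln (V k x) \<le> V k x - 1"
    using V_pos by (rule ln_le_minus_one)
  ultimately have "l * (ln (\<pi> k) + ((\<Sum>i<n. ln (p k (x i)) - ln (q (x i))) / l - n * ln A))
      \<le> l * (V k x - 1)"
    using l by (intro mult_left_mono) auto
  then have main: "l * ln (\<pi> k) + (\<Sum>i<n. ln (p k (x i)) - ln (q (x i))) - l * n * ln A
      \<le> l * (V k x - 1)"
    using l by (simp add: algebra_simps)
  have "(\<Sum>i<n. ln (q (x i) / p k0 (x i))) = (\<Sum>i<n. ln (q (x i)) - ln (p k0 (x i)))"
    using q_pos pos by (intro sum.cong) (auto simp: ln_div less_imp_neq[symmetric])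
  moreover have "ln (1 / \<pi> k) = - ln (\<pi> k)"
    using \<pi>[of k] by (simp add: ln_div)
  ultimately show ?thesis
    using main code by (simp add: sum_subtractf sum_negf)
qed

section \<open>Samples from the true density\<close>

context prob_space
begin

lemma nn_integral_likelihood_ratio_prod:
  assumes q: "probability_density \<mu> q" and p: "probability_density \<mu> p"
    and indep: "indep_vars (\<lambda>_. \<mu>) X {..<n}"
    and distr: "\<And>i. i < n \<Longrightarrow> distributed M \<mu> (X i) (\<lambda>x. ennreal (q x))"
    and s: "0 < s" "s < 1"
  shows "(\<integral>\<^sup>+\<omega>. ennreal (\<Prod>i<n. (p (X i \<omega>) / q (X i \<omega>)) powr s) \<partial>M)
    = ennreal (affinity \<mu> s q p ^ n)"
proof -
  have [measurable]: "q \<in> borel_measurable \<mu>" "p \<in> borel_measurable \<mu>"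
    using q p by (auto simp: probability_density_def)
  let ?f = "\<lambda>x. ennreal ((p x / q x) powr s)"
  have "(\<integral>\<^sup>+\<omega>. ennreal (\<Prod>i<n. (p (X i \<omega>) / q (X i \<omega>)) powr s) \<partial>M)
      = (\<integral>\<^sup>+\<omega>. (\<Prod>i<n. ?f (X i \<omega>)) \<partial>M)"
    by (simp add: prod_ennreal)
  also have "\<dots> = (\<Prod>i<n. \<integral>\<^sup>+\<omega>. ?f (X i \<omega>) \<partial>M)"
    by (intro indep_vars_nn_integral indep_vars_compose2[OF indep, where Y = "\<lambda>_. ?f"]) auto
  also have "\<dots> = (\<Prod>i<n. ennreal (affinity \<mu> s q p))"
  proof (rule prod.cong)
    fix i assume "i \<in> {..<n}"
    then have "(\<integral>\<^sup>+\<omega>. ?f (X i \<omega>) \<partial>M) = (\<integral>\<^sup>+x. ennreal (q x) * ?f x \<partial>\<mu>)"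
      using distr by (subst distributed_nn_integral) auto
    also have "\<dots> = (\<integral>\<^sup>+x. ?f x \<partial>density \<mu> (\<lambda>x. ennreal (q x)))"
      by (subst nn_integral_density) auto
    finally show "(\<integral>\<^sup>+\<omega>. ?f (X i \<omega>) \<partial>M) = ennreal (affinity \<mu> s q p)"
      by (simp add: nn_integral_likelihood_ratio_powr[OF q p s])
  qed simp
  finally show ?thesis
    by (simp add: ennreal_power affinity_nonneg)
qed

lemma AE_sample:
  fixes n :: nat
  assumes distr: "\<And>i. i < n \<Longrightarrow> distributed M \<mu> (X i) f"
    and P: "Measurable.pred \<mu> P" and AE: "AE x in density \<mu> f. P x"
  shows "AE \<omega> in M. \<forall>i<n. P (X i \<omega>)"
proof -
  have "AE \<omega> in M. P (X i \<omega>)" if "i < n" for i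
    using AE distributed_AE2[OF distr[OF that] P]
      distributed_borel_measurable[OF distr[OF that]]
    by (simp add: AE_density)
  then have "AE \<omega> in M. \<forall>i\<in>{..<n}. P (X i \<omega>)"
    by (intro AE_finite_allI) auto
  then show ?thesis by eventually_elim auto
qed

text \<open>
  A model of affinity 0 is mutually singular with \<open>q\<close>, hence almost surely assigns likelihood 0 to
  the first sample point. There are only countably many models, so almost surely this happens for
  all of the singular ones at once. A sample must have at least one point for this to hold.
\<close>

lemma AE_selected_affinity_pos:
  fixes p :: "'k::countable \<Rightarrow> 'b \<Rightarrow> real" and n :: nat
  assumes q: "probability_density \<mu> q" and p: "\<And>k. probability_density \<mu> (p k)"
    and distr: "\<And>i. i < n \<Longrightarrow> distributed M \<mu> (X i) (\<lambda>x. ennreal (q x))"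
    and n: "1 \<le> n" and s: "0 < s" "s < 1"
  shows "AE \<omega> in M. \<forall>k. (\<forall>i<n. 0 < p k (X i \<omega>)) \<longrightarrow> 0 < affinity \<mu> s q (p k)"
proof -
  have "AE \<omega> in M. (\<forall>i<n. 0 < p k (X i \<omega>)) \<longrightarrow> 0 < affinity \<mu> s q (p k)" for k
  proof (cases "affinity \<mu> s q (p k) = 0")
    case True
    let ?D = "density \<mu> (\<lambda>x. ennreal (q x))"
    have [measurable]: "q \<in> borel_measurable \<mu>" "p k \<in> borel_measurable \<mu>"
      using q p[of k] by (auto simp: probability_density_def)
    have "AE x in ?D. (p k x / q x) powr s = 0"
      using True integral_nonneg_eq_0_iff_AE[OF integrable_likelihood_ratio_powr[OF q p s]]
      by (simp add: affinity_def)
    moreover have "AE x in ?D. 0 < q x"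
      by (rule AE_density_pos) measurable
    ultimately have "AE x in ?D. \<not> 0 < p k x"
      by eventually_elim auto
    then have "AE \<omega> in M. \<forall>i<n. \<not> 0 < p k (X i \<omega>)"
      by (rule AE_sample[OF distr, rotated 2]) auto
    then show ?thesis
      by eventually_elim (use n in \<open>auto dest!: spec[of _ 0]\<close>)
  next
    case False
    then show ?thesis
      using affinity_nonneg[of \<mu> s q "p k"] by simp
  qed
  then show ?thesis
    by (simp add: AE_all_countable)
qed

lemma sample_log_likelihood_ratio:
  assumes q: "probability_density \<mu> q" and p: "probability_density \<mu> p"
    and distr: "\<And>i. i < n \<Longrightarrow> distributed M \<mu> (X i) (\<lambda>x. ennreal (q x))"
    and fin: "KL_div \<mu> q p < \<infinity>"
  shows "integrable M (\<lambda>\<omega>. \<Sum>i<n. ln (q (X i \<omega>) / p (X i \<omega>)))"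
    and "ereal (\<integral>\<omega>. (\<Sum>i<n. ln (q (X i \<omega>) / p (X i \<omega>))) \<partial>M) = ereal (real n) * KL_div \<mu> q p"
proof -
  let ?f = "\<lambda>x. ln (q x / p x)" and ?D = "density \<mu> (\<lambda>x. ennreal (q x))"
  have [measurable]: "q \<in> borel_measurable \<mu>" "p \<in> borel_measurable \<mu>"
    using q p by (auto simp: probability_density_def)
  have int: "integrable M (\<lambda>\<omega>. ?f (X i \<omega>))"
    and eq: "(\<integral>\<omega>. ?f (X i \<omega>) \<partial>M) = (\<integral>x. ?f x \<partial>?D)" if i: "i < n" for i
  proof -
    have X [measurable]: "X i \<in> measurable M \<mu>" and D: "distr M \<mu> (X i) = ?D"
      using distr[OF i] by (auto simp: distributed_def)
    show "integrable M (\<lambda>\<omega>. ?f (X i \<omega>))"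
      using KL_div_finite(2)[OF q p fin] by (simp add: D[symmetric] integrable_distr_eq)
    show "(\<integral>\<omega>. ?f (X i \<omega>) \<partial>M) = (\<integral>x. ?f x \<partial>?D)"
      by (simp add: D[symmetric] integral_distr)
  qed
  show "integrable M (\<lambda>\<omega>. \<Sum>i<n. ?f (X i \<omega>))"
    using int by (intro Bochner_Integration.integrable_sum) auto
  have "(\<integral>\<omega>. (\<Sum>i<n. ?f (X i \<omega>)) \<partial>M) = real n * (\<integral>x. ?f x \<partial>?D)"
    using int by (subst Bochner_Integration.integral_sum) (auto simp: eq)
  then show "ereal (\<integral>\<omega>. (\<Sum>i<n. ?f (X i \<omega>)) \<partial>M) = ereal (real n) * KL_div \<mu> q p"
    by (simp add: KL_div_finite(3)[OF q p fin])
qed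

end

section \<open>The risk bound\<close>

text \<open>
  The bound for a single competitor \<open>k\<close>. The pointwise estimate is integrated as it stands: the
  random variable \<open>V\<close> has mean at most 1, so its contribution \<open>\<lambda> (V - 1)\<close> can be dropped, and the
  log-likelihood ratio of the competitor has mean \<open>n\<close> times its divergence.
\<close>

lemma mdl_Renyi_risk_bound:
  fixes p :: "'k::countable \<Rightarrow> 'a \<Rightarrow> real" and K :: "'w \<Rightarrow> 'k"
  assumes q: "probability_density \<mu> q" and p: "\<And>k. probability_density \<mu> (p k)"
    and \<pi>: "\<And>k. 0 < \<pi> k" "(\<pi> has_sum 1) UNIV"
    and "prob_space M" and n: "1 \<le> n"
    and indep: "prob_space.indep_vars M (\<lambda>_. \<mu>) X {..<n}"
    and distr: "\<And>i. i < n \<Longrightarrow> distributed M \<mu> (X i) (\<lambda>x. ennreal (q x))"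
    and l: "1 < l" and \<rho>: "0 < \<rho>" "\<rho> \<le> 1 / l"
    and K [measurable]: "K \<in> measurable M (count_space UNIV)"
    and min: "\<And>\<omega>. \<omega> \<in> space M \<Longrightarrow>
      is_arg_min (mdl_objective p \<pi> l n (\<lambda>i. X i \<omega>)) (\<lambda>_. True) (K \<omega>)"
  shows "ext_expectation M (\<lambda>\<omega>. Renyi_div \<mu> \<rho> q (p (K \<omega>)))
    \<le> ereal (1 / (\<rho> * (l - 1))) * (KL_div \<mu> q (p k) + ereal (l / real n * ln (1 / \<pi> k)))"
proof (cases "KL_div \<mu> q (p k) < \<infinity>")
  case False
  then show ?thesis
    using \<rho> l by simp
next
  case fin: True
  interpret prob_space M by fact
  define s where "s = 1 / l"
  define A where "A k = affinity \<mu> s q (p k)" for k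
  \<comment> \<open>normalized to have mean 1; for a singular model, division by 0 makes it vanish\<close>
  define W where "W k \<omega> = (\<Prod>i<n. (p k (X i \<omega>) / q (X i \<omega>)) powr s) / A k ^ n" for k \<omega>
  define V where "V \<omega> = \<pi> (K \<omega>) * W (K \<omega>) \<omega>" for \<omega>
  define L where "L \<omega> = (\<Sum>i<n. ln (q (X i \<omega>) / p k (X i \<omega>)))" for \<omega>
  define c where "c = 1 / (\<rho> * (l - 1) * real n)"
  define G where "G \<omega> = c * (l * (V \<omega> - 1) + L \<omega> + l * ln (1 / \<pi> k))" for \<omega>
  have s: "0 < s" "s < 1" and c: "0 < c"
    using l \<rho> n by (auto simp: s_def c_def)
  have \<rho>1: "\<rho> < 1"
    using \<rho>(2) s(2) by (simp add: s_def)
  have [measurable]: "q \<in> borel_measurable \<mu>" "\<And>k. p k \<in> borel_measurable \<mu>"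
    using q p by (auto simp: probability_density_def)
  have X [measurable]: "X i \<in> measurable M \<mu>" if "i < n" for i
    using distr[OF that] by (auto simp: distributed_def)
  have W_meas [measurable]: "W k \<in> borel_measurable M" for k
    unfolding W_def[abs_def] by measurable
  have V_meas [measurable]: "V \<in> borel_measurable M"
    unfolding V_def[abs_def]
    by (rule measurable_compose_countable[where f = "\<lambda>k \<omega>. \<pi> k * W k \<omega>", OF _ K]) measurable
  have A_nonneg: "0 \<le> A k" for k
    by (simp add: A_def affinity_nonneg)
  have W_nonneg: "0 \<le> W k \<omega>" for k \<omega>
    using A_nonneg[of k] by (auto simp: W_def intro!: divide_nonneg_nonneg prod_nonneg)
  have V_nonneg: "0 \<le> V \<omega>" for \<omega>
    using W_nonneg \<pi>(1) by (simp add: V_def less_imp_le)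
  have W_le: "(\<integral>\<^sup>+\<omega>. ennreal (W k \<omega>) \<partial>M) \<le> 1" for k
  proof (cases "A k = 0")
    case True
    then show ?thesis using n by (simp add: W_def power_0_left)
  next
    case False
    then have "0 < A k ^ n"
      using A_nonneg[of k] by simp
    then have "(\<integral>\<^sup>+\<omega>. ennreal (W k \<omega>) \<partial>M)
        = (\<integral>\<^sup>+\<omega>. ennreal (\<Prod>i<n. (p k (X i \<omega>) / q (X i \<omega>)) powr s) \<partial>M) / ennreal (A k ^ n)"
      by (simp add: W_def nn_integral_divide divide_ennreal[symmetric] prod_nonneg)
    also have "\<dots> = ennreal (A k ^ n) / ennreal (A k ^ n)"
      by (simp only: nn_integral_likelihood_ratio_prod[OF q p indep distr s] A_def)
    also have "\<dots> = 1"
      using \<open>0 < A k ^ n\<close> False by (subst divide_ennreal) auto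
    finally show ?thesis by simp
  qed
  have V_le: "(\<integral>\<^sup>+\<omega>. ennreal (V \<omega>) \<partial>M) \<le> 1"
    unfolding V_def
    by (rule nn_integral_data_dependent_le_1) (use \<pi> W_le in \<open>auto simp: less_imp_le\<close>)
  have V_int: "integrable M V"
    using V_le by (intro integrableI_nonneg) (auto simp: V_nonneg le_less_trans)
  have V_mean: "(\<integral>\<omega>. V \<omega> \<partial>M) \<le> 1"
    using V_le nn_integral_eq_integral[OF V_int] by (simp add: V_nonneg)
  note L = sample_log_likelihood_ratio[of \<mu> q "p k" n X, OF q p distr fin, folded L_def]
  obtain d where d: "KL_div \<mu> q (p k) = ereal d"
    using KL_div_finite(3)[OF q p fin] by blast
  have L_mean: "(\<integral>\<omega>. L \<omega> \<partial>M) = n * d"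
    using L(2) by (simp add: d)
  have G_int: "integrable M G"
    unfolding G_def[abs_def] using V_int L(1) by simp
  have "(\<integral>\<omega>. G \<omega> \<partial>M) = c * (l * ((\<integral>\<omega>. V \<omega> \<partial>M) - 1) + n * d + l * ln (1 / \<pi> k))"
    unfolding G_def using V_int L(1) by (simp add: L_mean prob_space)
  also have "\<dots> \<le> c * (l * 0 + n * d + l * ln (1 / \<pi> k))"
    using V_mean c l by (intro mult_left_mono add_right_mono) auto
  also have "\<dots> = 1 / (\<rho> * (l - 1)) * (d + l / n * ln (1 / \<pi> k))"
    using n \<rho> l by (simp add: c_def field_simps)
  finally have G_mean: "(\<integral>\<omega>. G \<omega> \<partial>M) \<le> 1 / (\<rho> * (l - 1)) * (d + l / n * ln (1 / \<pi> k))" .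
  have "AE \<omega> in M. \<forall>i<n. 0 < p k (X i \<omega>)"
    by (rule AE_sample[OF distr _ KL_div_finite(1)[OF q p fin]]) auto
  moreover have "AE \<omega> in M. \<forall>i<n. 0 < q (X i \<omega>)"
    by (rule AE_sample[OF distr _ AE_density_pos]) auto
  moreover have "AE \<omega> in M. \<forall>k. (\<forall>i<n. 0 < p k (X i \<omega>)) \<longrightarrow> 0 < A k"
    unfolding A_def by (rule AE_selected_affinity_pos[OF q p distr n s])
  ultimately have "AE \<omega> in M. Renyi_div \<mu> \<rho> q (p (K \<omega>)) \<le> ereal (G \<omega>)"
    using AE_space
  proof eventually_elim
    case (elim \<omega>)
    have nonneg: "0 \<le> p j (X i \<omega>)" if "i < n" for i j
      using p[of j] measurable_space[OF X[OF that]] elim(4)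
      by (auto simp: probability_density_def)
    have "0 < p (K \<omega>) (X i \<omega>)" if "i < n" for i
      using mdl_minimizer_code_length(1)[OF nonneg min[OF elim(4)], of k i] elim(1) that by auto
    then have A_pos: "0 < A (K \<omega>)"
      using elim(3) by blast
    have "l * real n * (- ln (A (K \<omega>)))
        \<le> l * (V \<omega> - 1) + L \<omega> + l * ln (1 / \<pi> k)"
      unfolding V_def W_def L_def s_def
      by (rule affinity_code_length_bound[where p = p and q = q and \<pi> = \<pi>])
         (use nonneg elim A_pos \<pi> l min in auto)
    then have "c * (l * real n * (- ln (A (K \<omega>)))) \<le> G \<omega>"
      unfolding G_def using c by (intro mult_left_mono) auto
    moreover have "c * (l * real n * (- ln (A (K \<omega>))))
        = s / \<rho> * (- ln (A (K \<omega>)) / (s * (1 - s)))"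
      using n \<rho> l by (simp add: c_def s_def field_simps)
    ultimately have le_G: "s / \<rho> * (- ln (A (K \<omega>)) / (s * (1 - s))) \<le> G \<omega>"
      by simp
    have "ereal \<rho> * Renyi_div \<mu> \<rho> q (p (K \<omega>)) \<le> ereal s * Renyi_div \<mu> s q (p (K \<omega>))"
      by (rule times_Renyi_div_mono[OF q p]) (use \<rho> s in \<open>auto simp: s_def\<close>)
    also have "\<dots> = ereal (\<rho> * (s / \<rho> * (- ln (A (K \<omega>)) / (s * (1 - s)))))"
      using A_pos \<rho> by (simp add: Renyi_div_eq_affinity[OF q p s] A_def[symmetric])
    also have "\<dots> \<le> ereal (\<rho> * G \<omega>)"
      using le_G \<rho> by (simp only: ereal_less_eq mult_left_mono less_imp_le)
    finally show ?case
      using \<rho> by (cases "Renyi_div \<mu> \<rho> q (p (K \<omega>))") auto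
  qed
  then have "ext_expectation M (\<lambda>\<omega>. Renyi_div \<mu> \<rho> q (p (K \<omega>))) \<le> ereal (\<integral>\<omega>. G \<omega> \<partial>M)"
    by (intro ext_expectation_le_integral G_int Renyi_div_nonneg[OF q p \<rho>(1) \<rho>1])
  also have "\<dots> \<le> ereal (1 / (\<rho> * (l - 1)) * (d + l / n * ln (1 / \<pi> k)))"
    using G_mean by simp
  finally show ?thesis
    by (simp add: d)
qed

theorem theorem4p1:
  fixes \<mu> :: "'a measure"
    and q :: "'a \<Rightarrow> real"
    and p :: "'k::countable \<Rightarrow> 'a \<Rightarrow> real"
    and \<pi> :: "'k \<Rightarrow> real"
    and M :: "'w measure"
    and X :: "nat \<Rightarrow> 'w \<Rightarrow> 'a"
    and n :: nat
    and l :: real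
    and khat :: "(nat \<Rightarrow> 'a) \<Rightarrow> 'k"
  assumes q_density: "probability_density \<mu> q"
    and p_density: "\<And>k. probability_density \<mu> (p k)"
    and prior_pos: "\<And>k. \<pi> k > 0"
    and prior_sum: "(\<pi> has_sum 1) UNIV"
    and prob_space: "prob_space M"
    and n_pos: "n \<ge> 1"
    and X_indep: "prob_space.indep_vars M (\<lambda>_. \<mu>) X {..<n}"
    and X_distr: "\<And>i. i < n \<Longrightarrow> distributed M \<mu> (X i) (\<lambda>x. ennreal (q x))"
    and l_gt_1: "l > 1"
    and khat_measurable: "khat \<in> measurable (\<Pi>\<^sub>M i\<in>{..<n}. \<mu>) (count_space UNIV)"
    and khat_argmin:
      "\<And>\<omega>. \<omega> \<in> space M \<Longrightarrow>
         is_arg_min (mdl_objective p \<pi> l n (\<lambda>i\<in>{..<n}. X i \<omega>)) (\<lambda>_. True)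
           (khat (\<lambda>i\<in>{..<n}. X i \<omega>))"
  shows "\<forall>\<rho>\<in>{0<..1 / l}.
      ext_expectation M (\<lambda>\<omega>. ereal (rho_div \<mu> \<rho> q (p (khat (\<lambda>i\<in>{..<n}. X i \<omega>)))))
        \<le> ext_expectation M (\<lambda>\<omega>. Renyi_div \<mu> \<rho> q (p (khat (\<lambda>i\<in>{..<n}. X i \<omega>))))
    \<and> ext_expectation M (\<lambda>\<omega>. Renyi_div \<mu> \<rho> q (p (khat (\<lambda>i\<in>{..<n}. X i \<omega>))))
        \<le> ereal (1 / (\<rho> * (l - 1))) *
            (INF k. KL_div \<mu> q (p k) + ereal (l / real n * ln (1 / \<pi> k)))"
proof (intro ballI conjI)
  fix \<rho> assume "\<rho> \<in> {0<..1 / l}"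
  then have \<rho>: "0 < \<rho>" "\<rho> \<le> 1 / l"
    by auto
  then have \<rho>1: "\<rho> < 1"
    using l_gt_1 by (auto intro: le_less_trans)
  define K where "K \<omega> = khat (\<lambda>i\<in>{..<n}. X i \<omega>)" for \<omega>
  have "ext_expectation M (\<lambda>\<omega>. ereal (rho_div \<mu> \<rho> q (p (K \<omega>))))
      \<le> ext_expectation M (\<lambda>\<omega>. Renyi_div \<mu> \<rho> q (p (K \<omega>)))"
    by (intro ext_expectation_mono rho_div_le_Renyi_div q_density p_density \<rho>(1) \<rho>1)
  then show "ext_expectation M (\<lambda>\<omega>. ereal (rho_div \<mu> \<rho> q (p (khat (\<lambda>i\<in>{..<n}. X i \<omega>)))))
      \<le> ext_expectation M (\<lambda>\<omega>. Renyi_div \<mu> \<rho> q (p (khat (\<lambda>i\<in>{..<n}. X i \<omega>))))"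
    by (simp only: K_def)
  have "(\<lambda>\<omega>. \<lambda>i\<in>{..<n}. X i \<omega>) \<in> measurable M (\<Pi>\<^sub>M i\<in>{..<n}. \<mu>)"
    using X_distr by (intro measurable_restrict) (auto simp: distributed_def)
  then have K: "K \<in> measurable M (count_space UNIV)"
    unfolding K_def[abs_def] using khat_measurable by (rule measurable_compose)
  have objective: "mdl_objective p \<pi> l n (\<lambda>i\<in>{..<n}. x i) = mdl_objective p \<pi> l n x" for x
    by (rule ext) (simp add: mdl_objective_def)
  have min: "is_arg_min (mdl_objective p \<pi> l n (\<lambda>i. X i \<omega>)) (\<lambda>_. True) (K \<omega>)"
    if "\<omega> \<in> space M" for \<omega>
    using khat_argmin[OF that] by (simp only: K_def objective)
  let ?E = "ext_expectation M (\<lambda>\<omega>. Renyi_div \<mu> \<rho> q (p (K \<omega>)))"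
  have c: "0 < 1 / (\<rho> * (l - 1))"
    using \<rho> l_gt_1 by simp
  \<comment> \<open>the constant is moved to the left, so that the infimum can be treated termwise\<close>
  have "?E / ereal (1 / (\<rho> * (l - 1)))
      \<le> (INF k. KL_div \<mu> q (p k) + ereal (l / real n * ln (1 / \<pi> k)))"
    using c mdl_Renyi_risk_bound[OF q_density p_density prior_pos prior_sum prob_space n_pos
        X_indep X_distr l_gt_1 \<rho> K min]
    by (intro INF_greatest) (subst ereal_divide_le_pos, simp_all)
  then show "ext_expectation M (\<lambda>\<omega>. Renyi_div \<mu> \<rho> q (p (khat (\<lambda>i\<in>{..<n}. X i \<omega>))))
      \<le> ereal (1 / (\<rho> * (l - 1))) *
          (INF k. KL_div \<mu> q (p k) + ereal (l / real n * ln (1 / \<pi> k)))"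
    using c by (subst (asm) ereal_divide_le_pos) (simp_all only: K_def ereal_less zero_ereal_def, simp_all)
qed

end
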